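(* Let $(P,\cdot,\circ)$ be a transposed Novikov-Poisson algebra over a field $\mathbf{k}$ with $\operatorname{char}\mathbf{k}\neq 2$, and let $A$ be a subalgebra of $P$. Then $A^{k+1}=A\cdot A^{k}+A\circ A^{k}+A^{k}\circ A$ for all $k\ge 1$.
   Context: A (left) Novikov algebra $(P,\circ)$ is a vector space with a bilinear operation satisfying $(x\circ y)\circ z=(x\circ z)\circ y$ and $(x\circ y)\circ z-x\circ(y\circ z)=(y\circ x)\circ z-y\circ(x\circ z)$ for all $x,y,z$. A transposed Novikov-Poisson algebra is a triple $(P,\cdot,\circ)$ such that $(P,\cdot)$ is a commutative associative algebra (not necessarily unital), $(P,\circ)$ is a Novikov algebra, and for all $x,y,z\in P$: $(x\cdot y)\circ z=(x\cdot z)\circ y$ and $2z\cdot(x\circ y)=(z\cdot x)\circ y+x\circ(z\cdot y)$. For subspaces $X,Y$ of $P$, $X\cdot Y$ (resp. $X\circ Y$) denotes the linear span of all $x\cdot y$ (resp. $x\circ y$), $x\in X$, $y\in Y$. A subalgebra is a linear subspace $A$ with $A\cdot A+A\circ A\subseteq A$. The lower central series of a subalgebra $A$ is defined by $A^1=A$ and $A^n=\sum_{i=1}^{n-1}(A^i\cdot A^{n-i}+A^i\circ A^{n-i})$ for $n\ge 2$. *)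

theory Defs
  imports Complex_Main "HOL-Library.Set_Algebras"
begin

text \<open>Algebras are vector spaces whose carrier is a whole type, together with a bilinear
  operation, which need be neither associative nor unital.\<close>

locale bilinear_algebra = vector_space scale
  for scale :: "'k::field \<Rightarrow> 'p::ab_group_add \<Rightarrow> 'p" +
  fixes prd :: "'p \<Rightarrow> 'p \<Rightarrow> 'p"
  assumes linear_left: "Vector_Spaces.linear scale scale (\<lambda>x. prd x y)"
    and linear_right: "Vector_Spaces.linear scale scale (\<lambda>y. prd x y)"

locale comm_assoc_algebra = bilinear_algebra scale mul
  for scale :: "'k::field \<Rightarrow> 'p::ab_group_add \<Rightarrow> 'p"
    and mul :: "'p \<Rightarrow> 'p \<Rightarrow> 'p"  (infixl \<open>\<cdot>\<close> 70) +
  assumes mul_assoc: "(x \<cdot> y) \<cdot> z = x \<cdot> (y \<cdot> z)"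
    and mul_commute: "x \<cdot> y = y \<cdot> x"

locale novikov_algebra = bilinear_algebra scale circ
  for scale :: "'k::field \<Rightarrow> 'p::ab_group_add \<Rightarrow> 'p"
    and circ :: "'p \<Rightarrow> 'p \<Rightarrow> 'p"  (infixl \<open>\<odot>\<close> 70) +
  assumes right_commute: "(x \<odot> y) \<odot> z = (x \<odot> z) \<odot> y"
    and left_symmetric: "(x \<odot> y) \<odot> z - x \<odot> (y \<odot> z) = (y \<odot> x) \<odot> z - y \<odot> (x \<odot> z)"

locale transposed_novikov_poisson_algebra =
  comm_assoc_algebra scale mul + novikov_algebra scale circ
  for scale :: "'k::field \<Rightarrow> 'p::ab_group_add \<Rightarrow> 'p"
    and mul :: "'p \<Rightarrow> 'p \<Rightarrow> 'p"  (infixl \<open>\<cdot>\<close> 70)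
    and circ :: "'p \<Rightarrow> 'p \<Rightarrow> 'p"  (infixl \<open>\<odot>\<close> 70) +
  assumes mul_circ_swap: "(x \<cdot> y) \<odot> z = (x \<cdot> z) \<odot> y"
    and transposed_leibniz:
      "scale 2 (z \<cdot> (x \<odot> y)) = (z \<cdot> x) \<odot> y + x \<odot> (z \<cdot> y)"

definition span_product ::
  "('k::field \<Rightarrow> 'p::ab_group_add \<Rightarrow> 'p) \<Rightarrow> ('p \<Rightarrow> 'p \<Rightarrow> 'p) \<Rightarrow> 'p set \<Rightarrow> 'p set \<Rightarrow> 'p set"
  where "span_product scale prd X Y = module.span scale {prd x y | x y. x \<in> X \<and> y \<in> Y}"

text \<open>Here and below, \<open>+\<close> and \<open>\<Sum>\<close> on sets are elementwise (Minkowski) sums,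
  i.e. sums of subspaces.\<close>

definition subalgebra ::
  "('k::field \<Rightarrow> 'p::ab_group_add \<Rightarrow> 'p) \<Rightarrow> ('p \<Rightarrow> 'p \<Rightarrow> 'p) \<Rightarrow> ('p \<Rightarrow> 'p \<Rightarrow> 'p) \<Rightarrow> 'p set \<Rightarrow> bool"
  where "subalgebra scale mul circ A \<longleftrightarrow>
    module.subspace scale A \<and>
    span_product scale mul A A + span_product scale circ A A \<subseteq> A"

text \<open>The series starts at index 1; the value at index 0 is a dummy and is never used by the
  recursion.\<close>

fun lower_central ::
  "('k::field \<Rightarrow> 'p::ab_group_add \<Rightarrow> 'p) \<Rightarrow> ('p \<Rightarrow> 'p \<Rightarrow> 'p) \<Rightarrow> ('p \<Rightarrow> 'p \<Rightarrow> 'p) \<Rightarrow> 'p set \<Rightarrow> nat \<Rightarrow> 'p set"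
  where "lower_central scale mul circ A n =
    (if n \<le> 1 then A
     else \<Sum>i\<in>{1..n - 1}.
       span_product scale mul (lower_central scale mul circ A i) (lower_central scale mul circ A (n - i)) +
       span_product scale circ (lower_central scale mul circ A i) (lower_central scale mul circ A (n - i)))"

declare lower_central.simps [simp del]

end

(* Each product of x in A^i with y in A^j is reduced to index i = 1.  By induction
   A^i = A.A^(i-1) + A o A^(i-1) + A^(i-1) o A, so x may be taken to be a.u, a o u or u o a with
   a in A and u in A^(i-1).  Then
     (a.u) o y = (u.y) o a,   (u o a) o y = (u o y) o a,
     (a o u) o y = a o (u o y) + (u o y) o a - u o (a o y),
   and the last term lies in A^(i-1) o A^(j+1).  Once the products o are settled, so are the
   products . : (a.u).y = a.(u.y), and the transposed Leibniz rule expresses 2 y.(a o u) and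
   2 y.(u o a) through products o, where 2 is invertible. *)
theory Submission
  imports Defs
begin

section \<open>Sums of subspaces and spans of products\<close>

context vector_space
begin

lemma subspace_set_plus:
  assumes "subspace S" "subspace T"
  shows "subspace (S + T)"
proof (rule subspaceI)
  show "0 \<in> S + T"
    using assms set_plus_intro[of 0 S 0 T] by (simp add: subspace_0)
  show "x + y \<in> S + T" if xy: "x \<in> S + T" "y \<in> S + T" for x y
  proof -
    obtain a b c d where "x = a + b" "y = c + d" "a \<in> S" "c \<in> S" "b \<in> T" "d \<in> T"
      using xy by (auto elim!: set_plus_elim)
    then show ?thesis
      using assms set_plus_intro[of "a + c" S "b + d" T] by (simp add: subspace_add algebra_simps)
  qed
  show "scale c x \<in> S + T" if "x \<in> S + T" for c x
    using that assms by (auto elim!: set_plus_elim simp: scale_right_distrib subspace_scale set_plus_intro)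
qed

lemma set_plus_subset_subspace:
  assumes "subspace U" "S \<subseteq> U" "T \<subseteq> U"
  shows "S + T \<subseteq> U"
  using assms by (auto simp: set_plus_def intro!: subspace_add)

lemma subspace_subset_set_plus:
  assumes "subspace S" "subspace T"
  shows "S \<subseteq> S + T" "T \<subseteq> S + T"
  using set_zero_plus2[of S T] set_zero_plus2[of T S] assms
  by (simp_all add: subspace_0 add.commute)

lemma subspace_set_sum:
  "(\<And>i. i \<in> I \<Longrightarrow> subspace (S i)) \<Longrightarrow> subspace (\<Sum>i\<in>I. S i)"
  \<comment> \<open>A sum over an infinite index set is \<open>0\<close>, which for sets is the zero
    subspace \<open>{0}\<close>, so this case is settled like the empty one.\<close>
  by (induction I rule: infinite_finite_induct)
    (auto intro: subspace_set_plus simp: subspace_single_0 set_zero)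

lemma set_sum_subset_subspace:
  "subspace U \<Longrightarrow> (\<And>i. i \<in> I \<Longrightarrow> S i \<subseteq> U) \<Longrightarrow> (\<Sum>i\<in>I. S i) \<subseteq> U"
  by (induction I rule: infinite_finite_induct)
    (simp_all add: set_plus_subset_subspace subspace_0 set_zero)

lemma subspace_subset_set_sum:
  assumes "finite I" "i \<in> I" "\<And>j. j \<in> I \<Longrightarrow> subspace (S j)"
  shows "S i \<subseteq> (\<Sum>j\<in>I. S j)"
proof -
  have "S i \<subseteq> S i + (\<Sum>j\<in>I - {i}. S j)"
    using assms by (intro subspace_subset_set_plus(1) subspace_set_sum) auto
  then show ?thesis using assms by (simp add: sum.remove)
qed

lemma subspace_span_product: "subspace (span_product scale prd X Y)"
  by (simp add: span_product_def)

lemma span_product_memI: "x \<in> X \<Longrightarrow> y \<in> Y \<Longrightarrow> prd x y \<in> span_product scale prd X Y"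
  unfolding span_product_def by (rule span_base) auto

lemma span_product_subset:
  assumes "subspace U" "\<And>x y. x \<in> X \<Longrightarrow> y \<in> Y \<Longrightarrow> prd x y \<in> U"
  shows "span_product scale prd X Y \<subseteq> U"
  unfolding span_product_def by (rule span_minimal) (use assms in auto)

end

context bilinear_algebra
begin

text \<open>Lets a claim \<open>prd x y \<in> U\<close> with \<open>y\<close> fixed be checked only
  for \<open>x\<close> in a spanning set.\<close>

lemma subspace_vimage_left: "subspace U \<Longrightarrow> subspace {x. prd x y \<in> U}"
  using linear_left[of y] module_hom.subspace_vimage[of scale scale "\<lambda>x. prd x y" U]
  by (simp add: linear_iff_module_hom vimage_def)

end

section \<open>The lower central series and its one-step form\<close>

context transposed_novikov_poisson_algebra
begin

context
  fixes A :: "'p set"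
  assumes subspace_A: "subspace A"
begin

abbreviation lcs :: "nat \<Rightarrow> 'p set"
  where "lcs \<equiv> lower_central scale mul circ A"

abbreviation lcs_step :: "nat \<Rightarrow> 'p set"
  where "lcs_step k \<equiv> span_product scale mul A (lcs k) + span_product scale circ A (lcs k) +
    span_product scale circ (lcs k) A"

lemma lcs_1: "lcs (Suc 0) = A"
  by (simp add: lower_central.simps)

lemma subspace_lcs: "subspace (lcs n)"
  by (subst lower_central.simps)
    (auto intro!: subspace_set_sum subspace_set_plus subspace_span_product subspace_A)

text \<open>The left side is the summand of index \<open>i\<close> in the sum that defines
  \<open>lcs (i + j)\<close>; the bounds on \<open>i\<close> and \<open>j\<close> place
  \<open>i\<close> in the range of summation.\<close>

lemma span_products_subset_lcs:
  assumes "i \<ge> 1" "j \<ge> 1"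
  shows "span_product scale mul (lcs i) (lcs j) + span_product scale circ (lcs i) (lcs j)
    \<subseteq> lcs (i + j)"
proof -
  have "i \<in> {1..i + j - 1}" using assms by auto
  from subspace_subset_set_sum[OF _ this, of "\<lambda>m. span_product scale mul (lcs m) (lcs (i + j - m)) +
    span_product scale circ (lcs m) (lcs (i + j - m))"]
  show ?thesis using assms
    by (subst lower_central.simps[of _ _ _ _ "i + j"])
      (simp add: subspace_set_plus subspace_span_product)
qed

lemma span_product_mul_subset_lcs:
  "i \<ge> 1 \<Longrightarrow> j \<ge> 1 \<Longrightarrow> span_product scale mul (lcs i) (lcs j) \<subseteq> lcs (i + j)"
  and span_product_circ_subset_lcs:
  "i \<ge> 1 \<Longrightarrow> j \<ge> 1 \<Longrightarrow> span_product scale circ (lcs i) (lcs j) \<subseteq> lcs (i + j)"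
  using span_products_subset_lcs[of i j] subspace_subset_set_plus subspace_span_product by blast+

lemma mul_mem_lcs: "x \<in> lcs i \<Longrightarrow> y \<in> lcs j \<Longrightarrow> i \<ge> 1 \<Longrightarrow> j \<ge> 1 \<Longrightarrow> x \<cdot> y \<in> lcs (i + j)"
  and circ_mem_lcs: "x \<in> lcs i \<Longrightarrow> y \<in> lcs j \<Longrightarrow> i \<ge> 1 \<Longrightarrow> j \<ge> 1 \<Longrightarrow> x \<odot> y \<in> lcs (i + j)"
  using span_product_mul_subset_lcs span_product_circ_subset_lcs span_product_memI by blast+

lemma subspace_lcs_step: "subspace (lcs_step k)"
  by (intro subspace_set_plus subspace_span_product)

lemma lcs_step_subset_lcs:
  assumes "k \<ge> 1"
  shows "lcs_step k \<subseteq> lcs (Suc k)"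
  using assms span_product_mul_subset_lcs[of 1 k] span_product_circ_subset_lcs[of 1 k]
    span_product_circ_subset_lcs[of k 1]
  by (intro set_plus_subset_subspace subspace_lcs) (simp_all add: lcs_1)

lemma
  assumes "a \<in> A" "x \<in> lcs k"
  shows mul_mem_lcs_step: "a \<cdot> x \<in> lcs_step k"
    and circ_left_mem_lcs_step: "a \<odot> x \<in> lcs_step k"
    and circ_right_mem_lcs_step: "x \<odot> a \<in> lcs_step k"
proof -
  have "a \<cdot> x \<in> span_product scale mul A (lcs k)" "a \<odot> x \<in> span_product scale circ A (lcs k)"
    "x \<odot> a \<in> span_product scale circ (lcs k) A"
    using assms by (auto intro: span_product_memI)
  then show "a \<cdot> x \<in> lcs_step k" "a \<odot> x \<in> lcs_step k" "x \<odot> a \<in> lcs_step k"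
    using subspace_subset_set_plus subspace_set_plus subspace_span_product by (meson subsetD)+
qed

text \<open>Reduces a claim about \<open>lcs_step k\<close> to its three kinds of generators. In the
  uses below, \<open>U\<close> consists of all \<open>x\<close> whose product with a fixed
  \<open>y\<close> lies in the target.\<close>

lemma lcs_step_subset_subspace:
  assumes "subspace U"
    and "\<And>a u. a \<in> A \<Longrightarrow> u \<in> lcs k \<Longrightarrow> a \<cdot> u \<in> U"
    and "\<And>a u. a \<in> A \<Longrightarrow> u \<in> lcs k \<Longrightarrow> a \<odot> u \<in> U"
    and "\<And>a u. a \<in> A \<Longrightarrow> u \<in> lcs k \<Longrightarrow> u \<odot> a \<in> U"
  shows "lcs_step k \<subseteq> U"
  by (intro set_plus_subset_subspace span_product_subset assms)

text \<open>The premise \<open>step\<close> is what the induction hypothesis of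
  \<open>lcs_Suc\<close> provides; it decomposes the left factor. Both \<open>j\<close> and
  \<open>y\<close> stay free in the induction on \<open>i\<close>, since left symmetry passes an
  element of \<open>A\<close> from the left factor to the right one.\<close>

lemma circ_mem_lcs_step:
  assumes step: "\<And>m. 1 \<le> m \<Longrightarrow> m < k \<Longrightarrow> lcs (Suc m) = lcs_step m"
    and "x \<in> lcs i" "y \<in> lcs j" "i \<ge> 1" "j \<ge> 1" "i + j = Suc k"
  shows "x \<odot> y \<in> lcs_step k"
  using assms(2-)
proof (induction i arbitrary: x y j)
  case (Suc i)
  show ?case
  proof (cases "i = 0")
    \<comment> \<open>The actual base case: the left factor has index 1, so it lies in
      \<open>A\<close>, and \<open>j = k\<close>.\<close>
    case True
    then show ?thesis using Suc.prems by (auto simp: lcs_1 intro: circ_left_mem_lcs_step)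
  next
    case False
    then have i: "i \<ge> 1" "i < k" "i + j = k" using Suc.prems by auto
    have "lcs_step i \<subseteq> {x. x \<odot> y \<in> lcs_step k}"
    proof (rule lcs_step_subset_subspace)
      show "subspace {x. x \<odot> y \<in> lcs_step k}"
        by (intro subspace_lcs_step bilinear_algebra.subspace_vimage_left
            novikov_algebra.axioms(1)[OF novikov_algebra_axioms])
    next
      fix a u assume a: "a \<in> A" and u: "u \<in> lcs i"
      \<comment> \<open>Since \<open>i + j = k\<close>, multiplying \<open>u\<close> by
        \<open>y\<close> already reaches index \<open>k\<close>, and only the factor
        \<open>a\<close> is left over.\<close>
      have uy: "u \<cdot> y \<in> lcs k" "u \<odot> y \<in> lcs k"
        using mul_mem_lcs[OF u] circ_mem_lcs[OF u] Suc.prems i by blast+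
      have "(a \<cdot> u) \<odot> y = (u \<cdot> y) \<odot> a"
        by (metis mul_commute mul_circ_swap)
      then show "a \<cdot> u \<in> {x. x \<odot> y \<in> lcs_step k}"
        using circ_right_mem_lcs_step[OF a uy(1)] by simp
      have ua: "(u \<odot> a) \<odot> y \<in> lcs_step k"
        using circ_right_mem_lcs_step[OF a uy(2)] by (simp add: right_commute)
      then show "u \<odot> a \<in> {x. x \<odot> y \<in> lcs_step k}" by simp
      \<comment> \<open>The left index drops to \<open>i\<close> while the right one rises to
        \<open>Suc j\<close>; the total is still \<open>Suc k\<close>, so the induction hypothesis
        applies to \<open>u\<close> and \<open>a \<odot> y\<close>.\<close>
      have "a \<odot> y \<in> lcs (Suc j)"
        using circ_mem_lcs[of a "Suc 0" y j] a Suc.prems by (simp add: lcs_1)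
      then have "u \<odot> (a \<odot> y) \<in> lcs_step k"
        using Suc.IH[OF u] i by simp
      moreover have "(a \<odot> u) \<odot> y = a \<odot> (u \<odot> y) + (u \<odot> a) \<odot> y - u \<odot> (a \<odot> y)"
        using left_symmetric[of a u y] by (simp add: algebra_simps)
      ultimately show "a \<odot> u \<in> {x. x \<odot> y \<in> lcs_step k}"
        using ua circ_left_mem_lcs_step[OF a uy(2)] subspace_lcs_step
        by (simp add: subspace_add subspace_diff)
    qed
    then show ?thesis using Suc.prems step[OF i(1,2)] by auto
  qed
qed simp

text \<open>One decomposition of \<open>x\<close> suffices, without induction on \<open>i\<close>:
  every resulting term either has a factor in \<open>A\<close> or is a product
  \<open>\<odot>\<close> of total index \<open>Suc k\<close>, covered by
  \<open>circ_mem_lcs_step\<close>.\<close>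

lemma mul_mem_lcs_step_general:
  assumes two: "(2::'k) \<noteq> 0"
    and step: "\<And>m. 1 \<le> m \<Longrightarrow> m < k \<Longrightarrow> lcs (Suc m) = lcs_step m"
    and "x \<in> lcs i" "y \<in> lcs j" "i \<ge> 1" "j \<ge> 1" "i + j = Suc k"
  shows "x \<cdot> y \<in> lcs_step k"
proof (cases "i = 1")
  case True
  then show ?thesis using assms by (auto simp: lcs_1 intro: mul_mem_lcs_step)
next
  case False
  then obtain m where i: "i = Suc m" "m \<ge> 1" "m < k" "m + j = k"
    using assms by (cases i) auto
  have half: "z \<in> lcs_step k" if "scale 2 z \<in> lcs_step k" for z
    using subspace_scale[OF subspace_lcs_step that, of "1/2"] two by simp
  have "lcs_step m \<subseteq> {x. x \<cdot> y \<in> lcs_step k}"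
  proof (rule lcs_step_subset_subspace)
    show "subspace {x. x \<cdot> y \<in> lcs_step k}"
      by (intro subspace_lcs_step bilinear_algebra.subspace_vimage_left
          comm_assoc_algebra.axioms(1)[OF comm_assoc_algebra_axioms])
  next
    fix a u assume a: "a \<in> A" and u: "u \<in> lcs m"
    have yu: "y \<cdot> u \<in> lcs k"
      using mul_mem_lcs[OF u \<open>y \<in> lcs j\<close>] assms i by (simp add: mul_commute)
    have ya: "y \<cdot> a \<in> lcs (Suc j)"
      using mul_mem_lcs[of y j a "Suc 0"] a assms by (simp add: lcs_1)
    show "a \<cdot> u \<in> {x. x \<cdot> y \<in> lcs_step k}"
      using mul_mem_lcs_step[OF a yu] by (simp add: mul_assoc mul_commute[of u y])
    have yua: "(y \<cdot> u) \<odot> a \<in> lcs_step k"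
      by (rule circ_right_mem_lcs_step[OF a yu])
    \<comment> \<open>The Leibniz rule yields
      \<open>(y \<cdot> a) \<odot> u + a \<odot> (y \<cdot> u)\<close>, and swapping turns the first
      term into \<open>(y \<cdot> u) \<odot> a\<close>.\<close>
    have "scale 2 (y \<cdot> (a \<odot> u)) \<in> lcs_step k"
      using yua circ_left_mem_lcs_step[OF a yu]
      by (simp add: transposed_leibniz mul_circ_swap[of y a u] subspace_add subspace_lcs_step)
    then show "a \<odot> u \<in> {x. x \<cdot> y \<in> lcs_step k}"
      using half by (simp add: mul_commute[of _ y])
    \<comment> \<open>The second Leibniz term for \<open>u \<odot> a\<close>: its factors have
      indices \<open>m\<close> and \<open>Suc j\<close>, with sum \<open>Suc k\<close>.\<close>
    have "u \<odot> (y \<cdot> a) \<in> lcs_step k"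
      by (rule circ_mem_lcs_step[OF step u ya]) (use i in auto)
    then have "scale 2 (y \<cdot> (u \<odot> a)) \<in> lcs_step k"
      using yua by (simp add: transposed_leibniz subspace_add subspace_lcs_step)
    then show "u \<odot> a \<in> {x. x \<cdot> y \<in> lcs_step k}"
      using half by (simp add: mul_commute[of _ y])
  qed
  then show ?thesis using assms(3) i step[OF i(2,3)] by auto
qed

text \<open>Strong induction, because decomposing a factor of index \<open>i\<close> uses the
  formula at \<open>i - 1\<close>, which can be any positive index below \<open>k\<close>. The two
  preceding lemmas absorb every summand of \<open>lcs (Suc k)\<close>; the converse inclusion holds
  because \<open>A\<close> is the first term of the series.\<close>

lemma lcs_Suc:
  assumes two: "(2::'k) \<noteq> 0" and "k \<ge> 1"
  shows "lcs (Suc k) = lcs_step k"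
  using \<open>k \<ge> 1\<close>
proof (induction k rule: less_induct)
  case (less k)
  have step: "\<And>m. 1 \<le> m \<Longrightarrow> m < k \<Longrightarrow> lcs (Suc m) = lcs_step m"
    using less.IH by blast
  have "lcs (Suc k) = (\<Sum>i\<in>{1..k}. span_product scale mul (lcs i) (lcs (Suc k - i)) +
      span_product scale circ (lcs i) (lcs (Suc k - i)))"
    using less.prems by (subst lower_central.simps) simp
  also have "\<dots> \<subseteq> lcs_step k"
    by (intro set_sum_subset_subspace set_plus_subset_subspace span_product_subset subspace_lcs_step
        mul_mem_lcs_step_general[OF two step] circ_mem_lcs_step[OF step]) auto
  finally show ?case using lcs_step_subset_lcs less.prems by blast
qed

end

end

theorem proposition2p7:
  fixes scale :: "'k::field \<Rightarrow> 'p::ab_group_add \<Rightarrow> 'p"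
    and mul circ :: "'p \<Rightarrow> 'p \<Rightarrow> 'p"
    and A :: "'p set" and k :: nat
  assumes "transposed_novikov_poisson_algebra scale mul circ"
    and "CHAR('k) \<noteq> 2"
    and "subalgebra scale mul circ A"
    and "k \<ge> 1"
  shows "lower_central scale mul circ A (k + 1) =
    span_product scale mul A (lower_central scale mul circ A k) +
    span_product scale circ A (lower_central scale mul circ A k) +
    span_product scale circ (lower_central scale mul circ A k) A"
proof -
  have "(2::'k) \<noteq> 0"
  proof
    assume "(2::'k) = 0"
    \<comment> \<open>A divisor of 2 other than 2 is 1, and characteristic 1 would force
      \<open>1 = 0\<close> in the field.\<close>
    then have "CHAR('k) dvd 2"
      using of_nat_eq_0_iff_char_dvd[where 'a='k, of 2] by simp
    then have "CHAR('k) \<le> 2" "CHAR('k) \<noteq> 0"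
      using dvd_imp_le[of "CHAR('k)" 2] dvd_0_left_iff[of "2::nat"] by fastforce+
    then have "CHAR('k) = 1"
      using assms(2) by linarith
    then show False
      by simp
  qed
  then show ?thesis
    using transposed_novikov_poisson_algebra.lcs_Suc[OF assms(1)] assms(3,4)
    by (simp add: subalgebra_def)
qed

end
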